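(* Let $\mathbb{F}$ be a field, $\mathbb{V}$ a finite-dimensional $\mathbb{F}$-vector space, $T\in L(\mathbb{V})$ with minimal polynomial $m_T(x)=p(x)^d$, where $p(x)$ is a monic irreducible polynomial in $\mathbb{F}[x]$, and let $\mathbb{E}=\mathbb{F}[x]/(p(x))$. Then $\mathbb{V}$ admits a $T$-invariant $\mathbb{E}$-structure if and only if either $d=1$ or the formal derivative $p'(x)$ is not identically zero. Such a structure is unique if it is canonical; that is, there is at most one canonical $T$-invariant $\mathbb{E}$-structure on $\mathbb{V}$.
   Context: $L(\mathbb{V})$ is the $\mathbb{F}$-algebra of all linear maps $\mathbb{V}\to\mathbb{V}$; $Z_L(T)$ is the subalgebra of operators commuting with $T$. An $\mathbb{E}$-structure on $\mathbb{V}$ is an $\mathbb{F}$-algebra homomorphism $\sigma_{\mathbb{E}}:\mathbb{E}\to L(\mathbb{V})$; it makes $\mathbb{V}$ an $\mathbb{E}$-vector space. It is $T$-invariant if its image lies in $Z_L(T)$. Put $\mathbb{V}_i=\ker p(T)^i$, $0\le i\le d$. The operator induced by $T$ on $\mathbb{V}_i/\mathbb{V}_{i-1}$ has minimal polynomial $p(x)$, so $\mathbb{V}_i/\mathbb{V}_{i-1}$ carries the $\mathbb{E}$-structure induced by $T$, in which the class $[x]\in\mathbb{E}$ acts as the operator induced by $T$. A $T$-invariant $\mathbb{E}$-structure on $\mathbb{V}$ is canonical if: (i) each $T$-invariant subspace of $\mathbb{V}$ is an $\mathbb{E}$-subspace; (ii) for each $i=1,\dots,d$ the induced $\mathbb{E}$-structure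 on $\mathbb{V}_i/\mathbb{V}_{i-1}$ coincides with the one induced by $T$.
   Formalization: The equivalence is stated for canonical T-invariant E-structures; for arbitrary ones "only if" fails, e.g. F=F_2(t), p=x^2-t, d=2, V=W+W (direct sum) with W=F[x]/(p^2), T multiplication by x, [x] acting as (u,v)->(tv,u). *)

theory Defs
  imports
    Complex_Main
    "HOL-Computational_Algebra.Polynomial"
    "HOL-Algebra.QuotRing"
begin

section \<open>Operators and minimal polynomials\<close>

definition operator_ring :: "('f::field \<Rightarrow> 'v::ab_group_add \<Rightarrow> 'v) \<Rightarrow> ('v \<Rightarrow> 'v) ring" where
  "operator_ring scale =
    \<lparr>carrier = {S. Vector_Spaces.linear scale scale S},
     mult = (\<circ>), one = id,
     zero = (\<lambda>v. 0), add = (\<lambda>A B v. A v + B v)\<rparr>"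

definition op_centralizer ::
  "('f::field \<Rightarrow> 'v::ab_group_add \<Rightarrow> 'v) \<Rightarrow> ('v \<Rightarrow> 'v) \<Rightarrow> ('v \<Rightarrow> 'v) set" where
  "op_centralizer scale T = {S \<in> carrier (operator_ring scale). S \<circ> T = T \<circ> S}"

definition poly_op ::
  "('f::field \<Rightarrow> 'v::ab_group_add \<Rightarrow> 'v) \<Rightarrow> 'f poly \<Rightarrow> ('v \<Rightarrow> 'v) \<Rightarrow> 'v \<Rightarrow> 'v" where
  "poly_op scale q T = (\<lambda>v. \<Sum>i\<le>degree q. scale (coeff q i) ((T ^^ i) v))"

definition is_minimal_polynomial ::
  "('f::field \<Rightarrow> 'v::ab_group_add \<Rightarrow> 'v) \<Rightarrow> ('v \<Rightarrow> 'v) \<Rightarrow> 'f poly \<Rightarrow> bool" where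
  "is_minimal_polynomial scale T m \<longleftrightarrow>
     lead_coeff m = 1 \<and> poly_op scale m T = (\<lambda>v. 0) \<and>
     (\<forall>q. q \<noteq> 0 \<and> poly_op scale q T = (\<lambda>v. 0) \<longrightarrow> degree m \<le> degree q)"

section \<open>The algebra \<open>E = F[x]/(p)\<close>\<close>

definition polynomial_ring :: "'f::field poly ring" where
  "polynomial_ring = \<lparr>carrier = UNIV, mult = (*), one = 1, zero = 0, add = (+)\<rparr>"

definition ext_ring :: "'f::field poly \<Rightarrow> 'f poly set ring" where
  "ext_ring p = polynomial_ring Quot (PIdl\<^bsub>polynomial_ring\<^esub> p)"

definition residue_class :: "'f::field poly \<Rightarrow> 'f poly \<Rightarrow> 'f poly set" where
  "residue_class p f = (PIdl\<^bsub>polynomial_ring\<^esub> p) +>\<^bsub>polynomial_ring\<^esub> f"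

section \<open>E-structures\<close>

text \<open>
  Unital \<open>F\<close>-algebra homomorphisms from \<open>E\<close> to the linear operators. A scalar \<open>c\<close> acts on \<open>E\<close>
  as multiplication by the class of the constant polynomial \<open>c\<close>. Only the values of \<open>\<sigma>\<close> on the
  carrier of \<open>E\<close> are meaningful.
\<close>

definition E_structure ::
  "('f::field \<Rightarrow> 'v::ab_group_add \<Rightarrow> 'v) \<Rightarrow> 'f poly \<Rightarrow> ('f poly set \<Rightarrow> 'v \<Rightarrow> 'v) \<Rightarrow> bool" where
  "E_structure scale p \<sigma> \<longleftrightarrow>
     \<sigma> \<in> ring_hom (ext_ring p) (operator_ring scale) \<and>
     (\<forall>c. \<forall>e \<in> carrier (ext_ring p).
        \<sigma> (residue_class p [:c:] \<otimes>\<^bsub>ext_ring p\<^esub> e) = (\<lambda>v. scale c (\<sigma> e v)))"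

definition T_invariant_E_structure ::
  "('f::field \<Rightarrow> 'v::ab_group_add \<Rightarrow> 'v) \<Rightarrow> ('v \<Rightarrow> 'v) \<Rightarrow> 'f poly
     \<Rightarrow> ('f poly set \<Rightarrow> 'v \<Rightarrow> 'v) \<Rightarrow> bool" where
  "T_invariant_E_structure scale T p \<sigma> \<longleftrightarrow>
     E_structure scale p \<sigma> \<and> \<sigma> ` carrier (ext_ring p) \<subseteq> op_centralizer scale T"

definition T_invariant_subspace ::
  "('f::field \<Rightarrow> 'v::ab_group_add \<Rightarrow> 'v) \<Rightarrow> ('v \<Rightarrow> 'v) \<Rightarrow> 'v set \<Rightarrow> bool" where
  "T_invariant_subspace scale T W \<longleftrightarrow> Modules.module.subspace scale W \<and> T ` W \<subseteq> W"

definition E_subspace ::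
  "('f::field \<Rightarrow> 'v::ab_group_add \<Rightarrow> 'v) \<Rightarrow> 'f poly \<Rightarrow> ('f poly set \<Rightarrow> 'v \<Rightarrow> 'v)
     \<Rightarrow> 'v set \<Rightarrow> bool" where
  "E_subspace scale p \<sigma> W \<longleftrightarrow>
     Modules.module.subspace scale W \<and> (\<forall>e \<in> carrier (ext_ring p). \<sigma> e ` W \<subseteq> W)"

section \<open>Successive quotients of the kernel filtration\<close>

definition ker_filtration ::
  "('f::field \<Rightarrow> 'v::ab_group_add \<Rightarrow> 'v) \<Rightarrow> ('v \<Rightarrow> 'v) \<Rightarrow> 'f poly \<Rightarrow> nat \<Rightarrow> 'v set" where
  "ker_filtration scale T p i = {v. (poly_op scale p T ^^ i) v = 0}"

definition vcoset :: "'v::ab_group_add set \<Rightarrow> 'v \<Rightarrow> 'v set" where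
  "vcoset U v = (\<lambda>u. v + u) ` U"

definition vquotient :: "'v::ab_group_add set \<Rightarrow> 'v set \<Rightarrow> 'v set set" where
  "vquotient W U = vcoset U ` W"

text \<open>
  For additive \<open>S\<close> mapping \<open>U\<close> into \<open>U\<close>, the union below is the single coset \<open>S v + U\<close>,
  for any representative \<open>v\<close> of \<open>C\<close>.
\<close>

definition induced_op :: "'v::ab_group_add set \<Rightarrow> ('v \<Rightarrow> 'v) \<Rightarrow> 'v set \<Rightarrow> 'v set" where
  "induced_op U S C = (\<Union>v\<in>C. vcoset U (S v))"

text \<open>
  In the \<open>E\<close>-structure on \<open>V\<^sub>i/V\<^sub>i\<^sub>-\<^sub>1\<close> induced by \<open>T\<close>, the class of a polynomial \<open>f\<close> acts as \<open>f\<close>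
  evaluated at the operator induced by \<open>T\<close>, i.e. as the operator induced by \<open>f(T)\<close>. In particular
  the class of \<open>x\<close> acts as the operator induced by \<open>T\<close>.
\<close>

definition canonical_E_structure ::
  "('f::field \<Rightarrow> 'v::ab_group_add \<Rightarrow> 'v) \<Rightarrow> ('v \<Rightarrow> 'v) \<Rightarrow> 'f poly \<Rightarrow> nat
     \<Rightarrow> ('f poly set \<Rightarrow> 'v \<Rightarrow> 'v) \<Rightarrow> bool" where
  "canonical_E_structure scale T p d \<sigma> \<longleftrightarrow>
     T_invariant_E_structure scale T p \<sigma> \<and>
     (\<forall>W. T_invariant_subspace scale T W \<longrightarrow> E_subspace scale p \<sigma> W) \<and>
     (\<forall>i \<in> {1..d}. \<forall>f.
        \<forall>C \<in> vquotient (ker_filtration scale T p i) (ker_filtration scale T p (i - 1)).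
          induced_op (ker_filtration scale T p (i - 1)) (\<sigma> (residue_class p f)) C =
          induced_op (ker_filtration scale T p (i - 1)) (poly_op scale f T) C)"

end

theory Submission
  imports Defs
begin

text \<open>
  Write \<open>f(T)\<close> for the value of a polynomial \<open>f\<close> at \<open>T\<close>. The whole question can be decided one vector
  at a time. Let \<open>\<sigma>\<close> be canonical and \<open>v \<noteq> 0\<close>. The annihilator of \<open>v\<close> is generated by some
  \<open>p\<^sup>k\<close> with \<open>1 \<le> k \<le> d\<close> (\<open>order_exists\<close>, \<open>annihilator_power_dvd\<close>). The cyclic subspace of \<open>v\<close>
  is \<open>T\<close>-invariant, so the class of \<open>x\<close> sends \<open>v\<close> to \<open>g(T) v\<close> for some polynomial \<open>g\<close>. Since \<open>\<sigma>\<close>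
  commutes with \<open>T\<close>, the class of any \<open>f\<close> then sends \<open>v\<close> to \<open>f(g)(T) v\<close>. The class of \<open>p\<close> is zero, hence
  \<open>p\<^sup>k\<close> divides \<open>p(g)\<close>; the condition on \<open>V\<^sub>k/V\<^sub>k\<^sub>-\<^sub>1\<close> says that \<open>p\<close> divides \<open>g - x\<close>
  (\<open>canonical_local_root\<close>). So \<open>g\<close> is a root of \<open>p\<close> modulo \<open>p\<^sup>k\<close> that lifts the root \<open>x\<close> of \<open>p\<close>
  modulo \<open>p\<close>, and the theorem becomes Hensel's lemma in \<open>F[x]\<close> for the prime \<open>p\<close>, in which the
  derivative that has to be a unit modulo \<open>p\<close> is \<open>p'\<close>.

  If \<open>p' \<noteq> 0\<close> then \<open>p\<close> does not divide \<open>p'\<close>, for reasons of degree. The lift therefore exists modulo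
  \<open>p\<^sup>d\<close>, and \<open>f \<mapsto> f(g)(T)\<close> is a canonical structure (\<open>root_structure_canonical\<close>); the lift is
  also unique modulo \<open>p\<^sup>k\<close>, so two canonical structures agree at each \<open>v\<close> (\<open>canonical_unique\<close>). For
  \<open>d = 1\<close> there is nothing to lift. If \<open>p' = 0\<close>, the Taylor expansion gives \<open>p(g) \<equiv> p\<close> modulo
  \<open>p\<^sup>2\<close> for every \<open>g \<equiv> x\<close> modulo \<open>p\<close>, so no lift exists modulo \<open>p\<^sup>2\<close>. For \<open>d \<ge> 2\<close> a vector with
  annihilator \<open>p\<^sup>d\<close>, which exists because \<open>p\<^sup>d\<close> is the minimal polynomial, then excludes canonical
  structures (\<open>canonical_imp_separable\<close>).
\<close>

section \<open>Polynomials over a field modulo powers of an irreducible one\<close>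

text \<open>
  Euclidean division makes the ideal generated by \<open>f\<close> and \<open>p\<close> principal: a nonzero element \<open>g\<close> of least
  degree divides both. As \<open>p\<close> is irreducible, \<open>g\<close> is a unit or an associate of \<open>p\<close>, and the latter
  would make \<open>p\<close> divide \<open>f\<close>.
\<close>

lemma irreducible_bezout:
  fixes p f :: "'f::field poly"
  assumes p: "irreducible p" and nd: "\<not> p dvd f"
  shows "\<exists>a b. a * f + b * p = 1"
proof -
  define I where "I = {a * f + b * p | a b. True}"
  have I_comb: "a * x + b * y \<in> I" if xy: "x \<in> I" "y \<in> I" for a b x y
  proof -
    obtain s t s' t' where "x = s * f + t * p" "y = s' * f + t' * p"
      using xy unfolding I_def by auto
    then have "a * x + b * y = (a * s + b * s') * f + (a * t + b * t') * p"
      by (simp add: algebra_simps)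
    then show ?thesis unfolding I_def by blast
  qed
  have fI: "f \<in> I" unfolding I_def by (rule CollectI, rule exI[of _ 1], rule exI[of _ 0]) simp
  have pI: "p \<in> I" unfolding I_def by (rule CollectI, rule exI[of _ 0], rule exI[of _ 1]) simp
  have "f \<noteq> 0" using nd by auto
  then obtain g where g: "g \<in> I" "g \<noteq> 0" and
    gmin: "\<And>h. h \<in> I \<Longrightarrow> h \<noteq> 0 \<Longrightarrow> degree g \<le> degree h"
    using ex_has_least_nat[of "\<lambda>h. h \<in> I \<and> h \<noteq> 0" f degree] fI by auto
  have gdvd: "g dvd h" if "h \<in> I" for h
  proof -
    have "h mod g = 1 * h + (- (h div g)) * g"
      by (simp add: minus_div_mult_eq_mod)
    also have "\<dots> \<in> I" using that g(1) by (rule I_comb)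
    finally have "h mod g \<in> I" .
    then have "h mod g = 0"
      using gmin[of "h mod g"] degree_mod_less[of g h] g(2) by fastforce
    then show ?thesis by (simp add: mod_eq_0_iff_dvd)
  qed
  obtain c where c: "p = g * c" using gdvd[OF pI] by blast
  have "g dvd 1"
  proof (rule ccontr)
    assume "\<not> g dvd 1"
    then have "c dvd 1" using p c irreducibleD by blast
    then have "p dvd g" unfolding c by (simp add: mult_unit_dvd_iff)
    then show False using gdvd[OF fI] nd dvd_trans by blast
  qed
  then obtain s where "1 = g * s" by blast
  then have "1 = s * g + 0 * g" by (simp add: mult.commute)
  also have "\<dots> \<in> I" using g(1) by (intro I_comb)
  finally obtain a b where "1 = a * f + b * p" unfolding I_def by blast
  then show ?thesis by metis
qed

lemma irreducible_not_dvd_mult: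
  fixes p :: "'f::field poly"
  assumes "irreducible p" "\<not> p dvd c" "p ^ k dvd u * c"
  shows "p ^ k dvd u"
  using assms(3)
proof (induction k)
  case (Suc k)
  then have "p ^ k dvd u * c" by (metis dvd_mult_right power_Suc)
  then obtain w where w: "u = p ^ k * w" using Suc.IH by blast
  obtain a b where ab: "a * c + b * p = 1" using irreducible_bezout[OF assms(1,2)] by blast
  have "p ^ k * p dvd p ^ k * (w * c)" using Suc.prems w by (simp add: mult_ac)
  then have "p dvd w * c" using assms(1) by auto
  then have "p dvd a * (w * c) + (w * b) * p" by simp
  also have "a * (w * c) + (w * b) * p = w * (a * c + b * p)" by (simp add: algebra_simps)
  also have "\<dots> = w" by (simp add: ab)
  finally show ?case unfolding w by (simp add: mult.commute)
qed simp

lemma irreducible_not_dvd_one: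
  fixes p :: "'f::field poly"
  shows "irreducible p \<Longrightarrow> \<not> p dvd 1"
  by (simp add: irreducible_not_unit)

text \<open>
  As \<open>p'\<close> has smaller degree than \<open>p\<close>, it is invertible modulo \<open>p\<close> as soon as it is nonzero. This is
  the condition on the derivative in Hensel's lemma.
\<close>

lemma irreducible_not_dvd_pderiv:
  fixes p :: "'f::field poly"
  assumes "irreducible p" "pderiv p \<noteq> 0"
  shows "\<not> p dvd pderiv p"
proof
  assume "p dvd pderiv p"
  then have "degree p \<le> degree (pderiv p)" using assms(2) by (rule dvd_imp_degree_le)
  also have "\<dots> \<le> degree p - 1" by (rule degree_le) (auto simp: coeff_pderiv coeff_eq_0)
  finally have "degree p = 0" by simp
  then obtain c where "p = [:c:]" by (rule degree_eq_zeroE)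
  then show False using assms(2) by (simp add: pderiv_pCons)
qed

lemma pcompose_taylor:
  fixes f g u :: "'a::idom poly"
  shows "\<exists>r. pcompose f (g + u) = pcompose f g + u * pcompose (pderiv f) g + u\<^sup>2 * r"
proof (induction f)
  case (pCons a h)
  then obtain r where r: "pcompose h (g + u) = pcompose h g + u * pcompose (pderiv h) g + u\<^sup>2 * r"
    by blast
  have "pcompose (pCons a h) (g + u) = pcompose (pCons a h) g + u * pcompose (pderiv (pCons a h)) g
      + u\<^sup>2 * (pcompose (pderiv h) g + (g + u) * r)"
    by (simp add: pcompose_pCons pderiv_pCons pcompose_add r algebra_simps power2_eq_square)
  then show ?case by blast
qed simp

lemma pcompose_diff_dvd:
  fixes f g h :: "'a::idom poly"
  shows "g - h dvd pcompose f g - pcompose f h"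
proof -
  obtain r where "pcompose f (h + (g - h)) =
      pcompose f h + (g - h) * pcompose (pderiv f) h + (g - h)\<^sup>2 * r"
    using pcompose_taylor by blast
  then have "pcompose f g - pcompose f h = (g - h) * (pcompose (pderiv f) h + (g - h) * r)"
    by (simp add: algebra_simps power2_eq_square)
  then show ?thesis by simp
qed

text \<open>
  One Newton step: if \<open>a\<close> inverts \<open>p'\<close> modulo \<open>p\<close>, then replacing \<open>g\<close> by \<open>g - a p(g)\<close> cancels the
  leading error, because \<open>p'(g) \<equiv> p'\<close> modulo \<open>p\<close>. The exponent \<open>Suc n\<close> starts the
  induction at the modulus \<open>p\<close>, where \<open>x\<close> already is a root.
\<close>

lemma hensel_root_exists:
  fixes p :: "'f::field poly"
  assumes p: "irreducible p" and "n = 0 \<or> pderiv p \<noteq> 0"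
  shows "\<exists>g. p dvd g - [:0, 1:] \<and> p ^ Suc n dvd pcompose p g"
  using assms(2)
proof (induction n)
  case 0
  show ?case by (rule exI[of _ "[:0, 1:]"]) simp
next
  case (Suc n)
  then have "pderiv p \<noteq> 0" by simp
  obtain g where g: "p dvd g - [:0, 1:]" "p ^ Suc n dvd pcompose p g"
    using Suc by auto
  obtain a b where ab: "a * pderiv p + b * p = 1"
    using irreducible_bezout[OF p irreducible_not_dvd_pderiv[OF p \<open>pderiv p \<noteq> 0\<close>]] by blast
  define u where "u = - (a * pcompose p g)"
  obtain r where r: "pcompose p (g + u) =
      pcompose p g + u * pcompose (pderiv p) g + u\<^sup>2 * r"
    using pcompose_taylor by blast
  have "p dvd pcompose (pderiv p) g - pderiv p"
    using dvd_trans[OF g(1) pcompose_diff_dvd[of g "[:0, 1:]" "pderiv p"]] by simp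
  then have "p dvd b * p - a * (pcompose (pderiv p) g - pderiv p)" by (intro dvd_diff) auto
  also have "b * p - a * (pcompose (pderiv p) g - pderiv p) =
      (a * pderiv p + b * p) - a * pcompose (pderiv p) g"
    by (simp add: algebra_simps)
  finally have c: "p dvd 1 - a * pcompose (pderiv p) g" by (simp only: ab)
  have "pcompose p g + u * pcompose (pderiv p) g =
      (1 - a * pcompose (pderiv p) g) * pcompose p g"
    by (simp add: u_def algebra_simps)
  moreover have "p ^ Suc (Suc n) dvd (1 - a * pcompose (pderiv p) g) * pcompose p g"
    using mult_dvd_mono[OF c g(2)] by simp
  \<comment> \<open>the quadratic Taylor term is negligible: \<open>u\<close> contains both the factor \<open>p\<close> and the factor \<open>p\<^sup>n\<^sup>+\<^sup>1\<close>\<close>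
  moreover have pu: "p ^ Suc n dvd u" using g(2) by (simp add: u_def)
  have "p dvd u" using pu by (metis dvd_mult_left power_Suc)
  then have "p ^ Suc (Suc n) dvd u\<^sup>2" using mult_dvd_mono[OF _ pu] by (simp add: power2_eq_square)
  ultimately have "p ^ Suc (Suc n) dvd pcompose p (g + u)" unfolding r
    by (metis dvd_add dvd_mult2)
  moreover have "p dvd (g + u) - [:0, 1:]"
    using dvd_add[OF g(1) \<open>p dvd u\<close>] by (simp add: algebra_simps)
  ultimately show ?case by blast
qed

text \<open>
  The difference \<open>p(g) - p(h)\<close> factors as \<open>(g - h) c\<close> with \<open>c \<equiv> p'\<close> modulo \<open>p\<close>. So \<open>c\<close> is prime to
  \<open>p\<close>, and all of \<open>p\<^sup>n\<^sup>+\<^sup>1\<close> must divide \<open>g - h\<close>.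
\<close>

lemma hensel_root_unique:
  fixes p :: "'f::field poly"
  assumes p: "irreducible p" and n: "n = 0 \<or> pderiv p \<noteq> 0"
    and g: "p dvd g - [:0, 1:]" "p ^ Suc n dvd pcompose p g"
    and h: "p dvd h - [:0, 1:]" "p ^ Suc n dvd pcompose p h"
  shows "p ^ Suc n dvd g - h"
proof -
  have gh: "p dvd g - h" using dvd_diff[OF g(1) h(1)] by simp
  show ?thesis
  proof (cases "n = 0")
    case False
    then have p': "\<not> p dvd pderiv p" using n irreducible_not_dvd_pderiv[OF p] by blast
    obtain r where r: "pcompose p (h + (g - h)) =
        pcompose p h + (g - h) * pcompose (pderiv p) h + (g - h)\<^sup>2 * r"
      using pcompose_taylor by blast
    define c where "c = pcompose (pderiv p) h + (g - h) * r"
    have "pcompose p g - pcompose p h = (g - h) * c"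
      using r by (simp add: c_def algebra_simps power2_eq_square)
    then have "p ^ Suc n dvd (g - h) * c" using dvd_diff[OF g(2) h(2)] by simp
    moreover have "\<not> p dvd c"
    proof
      assume "p dvd c"
      moreover have "p dvd pcompose (pderiv p) h - pderiv p"
        using dvd_trans[OF h(1) pcompose_diff_dvd[of h "[:0, 1:]" "pderiv p"]] by simp
      ultimately have "p dvd c - (g - h) * r - (pcompose (pderiv p) h - pderiv p)"
        using gh by (meson dvd_diff dvd_mult2)
      then show False using p' by (simp add: c_def)
    qed
    ultimately show ?thesis using irreducible_not_dvd_mult[OF p] by blast
  qed (use gh in simp)
qed

text \<open>
  Without a linear Taylor term, \<open>p(g)\<close> is congruent to \<open>p\<close> itself modulo \<open>p\<^sup>2\<close>.
\<close>

lemma hensel_root_obstruction: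
  fixes p :: "'f::field poly"
  assumes p: "irreducible p" and "pderiv p = 0"
    and g: "p dvd g - [:0, 1:]"
  shows "\<not> p\<^sup>2 dvd pcompose p g"
proof
  assume a: "p\<^sup>2 dvd pcompose p g"
  obtain r where "pcompose p ([:0, 1:] + (g - [:0, 1:])) =
      pcompose p [:0, 1:] + (g - [:0, 1:]) * pcompose (pderiv p) [:0, 1:] + (g - [:0, 1:])\<^sup>2 * r"
    using pcompose_taylor by blast
  then have "p = pcompose p g - (g - [:0, 1:])\<^sup>2 * r"
    using assms(2) by (simp add: algebra_simps)
  moreover have "p\<^sup>2 dvd pcompose p g - (g - [:0, 1:])\<^sup>2 * r"
    using a dvd_power_same[OF g, of 2] by (intro dvd_diff dvd_mult2)
  ultimately have "p * p dvd p * 1" by (simp add: power2_eq_square)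
  then show False using p irreducible_not_dvd_one[OF p] by auto
qed

section \<open>The residue ring\<close>

lemma polynomial_ring_simps [simp]:
  "carrier polynomial_ring = UNIV" "mult polynomial_ring = (*)" "one polynomial_ring = 1"
  "zero polynomial_ring = 0" "add polynomial_ring = (+)"
  by (simp_all add: polynomial_ring_def)

lemma cring_polynomial_ring: "cring (polynomial_ring :: 'f::field poly ring)"
proof (rule cringI)
  show "abelian_group (polynomial_ring :: 'f poly ring)"
    by (rule abelian_groupI) (auto simp: algebra_simps intro: exI[of _ "- x" for x])
  show "comm_monoid (polynomial_ring :: 'f poly ring)"
    by (rule comm_monoidI) (auto simp: algebra_simps)
qed (simp add: algebra_simps)

lemma ideal_PIdl: "ideal (PIdl\<^bsub>polynomial_ring\<^esub> p) (polynomial_ring :: 'f::field poly ring)"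
  using cring.cgenideal_ideal[OF cring_polynomial_ring] by simp

lemma residue_class_eq: "residue_class p f = {h. p dvd h - f}"
proof -
  have "(\<exists>q. h = q * p + f) \<longleftrightarrow> p dvd h - f" for h
    by (metis add_diff_cancel_right' diff_add_cancel dvd_def mult.commute)
  then show ?thesis
    by (auto simp: residue_class_def a_r_coset_def' cgenideal_def)
qed

lemma carrier_ext_ring: "carrier (ext_ring p) = range (residue_class p)"
  by (auto simp: ext_ring_def FactRing_def A_RCOSETS_def' residue_class_def)

lemma mult_ext_ring:
  "residue_class p f \<otimes>\<^bsub>ext_ring p\<^esub> residue_class p g = residue_class p (f * g)"
  using ideal.rcoset_mult_add[OF ideal_PIdl, of f g]
  by (simp add: ext_ring_def FactRing_def residue_class_def)

lemma add_ext_ring: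
  "residue_class p f \<oplus>\<^bsub>ext_ring p\<^esub> residue_class p g = residue_class p (f + g)"
  using abelian_subgroup.a_rcos_sum[OF abelian_subgroupI3[OF ideal.axioms(1)[OF ideal_PIdl]
      ring.is_abelian_group[OF cring.axioms(1)[OF cring_polynomial_ring]]], of f g]
  by (simp add: ext_ring_def FactRing_def residue_class_def)

lemma one_ext_ring: "\<one>\<^bsub>ext_ring p\<^esub> = residue_class p 1"
  by (simp add: ext_ring_def FactRing_def residue_class_def)

section \<open>Polynomials in a linear operator\<close>

locale linear_operator = vector_space scale
  for scale :: "'f::field \<Rightarrow> 'v::ab_group_add \<Rightarrow> 'v" +
  fixes T :: "'v \<Rightarrow> 'v"
  assumes T_linear: "Vector_Spaces.linear scale scale T"
begin

abbreviation ev :: "'f poly \<Rightarrow> 'v \<Rightarrow> 'v" where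
  "ev f \<equiv> poly_op scale f T"

lemma linear_selfI:
  assumes "\<And>x y. S (x + y) = S x + S y" "\<And>c x. S (scale c x) = scale c (S x)"
  shows "Vector_Spaces.linear scale scale S"
  by (intro Vector_Spaces.linear.intro module_hom.intro module_hom_axioms.intro
      vector_space_axioms module_axioms assms)

lemma linear_selfD:
  assumes "Vector_Spaces.linear scale scale S"
  shows "S (x + y) = S x + S y" "S (x - y) = S x - S y"
    "S (scale c x) = scale c (S x)" "S 0 = 0"
proof -
  interpret S: Vector_Spaces.linear scale scale S by fact
  show "S (x + y) = S x + S y" "S (x - y) = S x - S y"
    "S (scale c x) = scale c (S x)" "S 0 = 0"
    by (rule S.add S.diff S.scale S.zero)+
qed

lemmas T_simps = linear_selfD[OF T_linear]

lemma T_sum: "T (sum h A) = (\<Sum>i\<in>A. T (h i))"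
  by (induction A rule: infinite_finite_induct) (simp_all add: T_simps)

lemma ev_0 [simp]: "ev 0 v = 0"
  by (simp add: poly_op_def)

lemma ev_pCons [simp]: "ev (pCons c f) v = scale c v + T (ev f v)"
proof (cases "f = 0")
  case True
  then show ?thesis by (simp add: poly_op_def T_simps)
next
  case False
  then show ?thesis
    by (simp add: poly_op_def T_sum T_simps sum.atMost_Suc_shift del: sum.atMost_Suc)
qed

lemma ev_1 [simp]: "ev 1 v = v"
  by (simp add: one_pCons T_simps del: pCons_one)

lemma ev_linear: "Vector_Spaces.linear scale scale (ev f)"
proof (rule linear_selfI)
  show "ev f (x + y) = ev f x + ev f y" for x y
    by (induction f) (simp_all add: T_simps scale_right_distrib algebra_simps)
  show "ev f (scale c x) = scale c (ev f x)" for c x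
    by (induction f) (simp_all add: T_simps scale_right_distrib mult.commute)
qed

lemmas ev_linear_simps = linear_selfD[OF ev_linear]

lemma ev_add: "ev (f + g) v = ev f v + ev g v"
proof (induction f arbitrary: g)
  case (pCons a f)
  obtain b h where g: "g = pCons b h" by (cases g)
  have "ev (pCons a f + g) v = scale (a + b) v + T (ev f v + ev h v)"
    by (simp add: g pCons.IH)
  then show ?case by (simp add: g T_simps scale_left_distrib add_ac)
qed simp

lemma ev_smult: "ev (smult c f) v = scale c (ev f v)"
  by (induction f) (simp_all add: T_simps scale_right_distrib)

lemma ev_mult: "ev (f * g) v = ev f (ev g v)"
  by (induction f) (simp_all add: ev_add ev_smult)

lemma ev_diff: "ev (f - g) v = ev f v - ev g v"
  using ev_add[of "f - g" g v] by (simp add: algebra_simps)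

lemma ev_commute: "ev f (ev g v) = ev g (ev f v)"
  by (metis ev_mult mult.commute)

lemma ev_power: "(ev p ^^ i) v = ev (p ^ i) v"
  by (induction i) (simp_all add: ev_mult)

lemma ev_dvd: "p dvd f \<Longrightarrow> ev p v = 0 \<Longrightarrow> ev f v = 0"
  by (metis dvd_def ev_linear_simps(4) ev_mult mult.commute)

lemma ev_commute_operator:
  assumes S: "Vector_Spaces.linear scale scale S" and "\<And>v. S (T v) = T (S v)"
  shows "S (ev f v) = ev f (S v)"
  by (induction f) (simp_all add: linear_selfD[OF S] assms(2))

lemma ker_filtration_iff: "v \<in> ker_filtration scale T p i \<longleftrightarrow> ev (p ^ i) v = 0"
  by (simp add: ker_filtration_def ev_power)

lemma ker_filtration_0: "0 \<in> ker_filtration scale T p i"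
  by (simp add: ker_filtration_iff ev_linear_simps)

lemma ker_filtration_add:
  "u \<in> ker_filtration scale T p i \<Longrightarrow> v \<in> ker_filtration scale T p i \<Longrightarrow>
   u + v \<in> ker_filtration scale T p i"
  by (simp add: ker_filtration_iff ev_linear_simps)

lemma ker_filtration_diff:
  "u \<in> ker_filtration scale T p i \<Longrightarrow> v \<in> ker_filtration scale T p i \<Longrightarrow>
   u - v \<in> ker_filtration scale T p i"
  by (simp add: ker_filtration_iff ev_linear_simps)

lemma ker_filtration_ev:
  "v \<in> ker_filtration scale T p i \<Longrightarrow> ev f v \<in> ker_filtration scale T p i"
  by (simp add: ker_filtration_iff ev_commute[of "p ^ i"] ev_linear_simps)

lemma ev_invariant_subspace:
  assumes W: "T_invariant_subspace scale T W" and "w \<in> W"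
  shows "ev f w \<in> W"
proof -
  have "subspace W" "T ` W \<subseteq> W" using W by (auto simp: T_invariant_subspace_def)
  then show ?thesis
    by (induction f) (auto simp: subspace_0 assms(2) intro!: subspace_add subspace_scale)
qed

lemma cyclic_invariant_subspace: "T_invariant_subspace scale T (range (\<lambda>f. ev f v))"
proof -
  have "0 = ev 0 v" "ev f v + ev g v = ev (f + g) v" "scale c (ev f v) = ev (smult c f) v"
    "T (ev f v) = ev (pCons 0 f) v" for f g c
    by (simp_all add: ev_add ev_smult)
  then show ?thesis
    unfolding T_invariant_subspace_def by (intro conjI subspaceI) blast+
qed

text \<open>
  If only \<open>p\<^sup>j\<close> with \<open>j \<le> k\<close> divided \<open>f\<close>, then \<open>p\<^sup>k\<close> would be a combination of \<open>f\<close> and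
  \<open>p\<^sup>k\<^sup>+\<^sup>1\<close> and would annihilate \<open>v\<close>.
\<close>

lemma annihilator_power_dvd:
  assumes p: "irreducible p"
    and ord: "ev (p ^ k) v \<noteq> 0" "ev (p ^ Suc k) v = 0" and f: "ev f v = 0"
  shows "p ^ Suc k dvd f"
proof -
  have "p ^ j dvd f" if "j \<le> Suc k" for j
    using that
  proof (induction j)
    case (Suc j)
    then obtain c where c: "f = p ^ j * c" by (auto elim: dvdE)
    have "p dvd c"
    proof (rule ccontr)
      assume "\<not> p dvd c"
      then obtain a b where ab: "a * c + b * p = 1" using irreducible_bezout[OF p] by blast
      have "p ^ k = p ^ k * (a * c + b * p)" by (simp add: ab)
      also have "\<dots> = a * p ^ (k - j) * f + b * p ^ Suc k"
        using Suc.prems by (simp add: c algebra_simps flip: power_add)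
      finally have "ev (p ^ k) v = ev (a * p ^ (k - j) * f + b * p ^ Suc k) v" by simp
      also have "\<dots> = 0" by (simp only: ev_add ev_mult[of _ f] ev_mult[of b] f ord(2) ev_linear_simps add_0)
      finally show False using ord(1) by simp
    qed
    then show ?case by (simp add: c mult.commute)
  qed simp
  then show ?thesis by blast
qed

lemma order_exists:
  assumes "ev (p ^ d) v = 0" "v \<noteq> 0"
  obtains k where "k < d" "ev (p ^ k) v \<noteq> 0" "ev (p ^ Suc k) v = 0"
proof -
  define n where "n = (LEAST n. ev (p ^ n) v = 0)"
  have n: "ev (p ^ n) v = 0" unfolding n_def by (rule LeastI, rule assms(1))
  have le: "n \<le> d" unfolding n_def by (rule Least_le, rule assms(1))
  have "n \<noteq> 0" using n assms(2) by (cases n) auto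
  then obtain k where k: "n = Suc k" by (cases n) auto
  have "ev (p ^ k) v \<noteq> 0" using not_less_Least[of k "\<lambda>n. ev (p ^ n) v = 0"] k n_def by simp
  then show ?thesis using that[of k] n le k by auto
qed

section \<open>Canonical structures act locally through an approximate root\<close>

text \<open>
  The algebra homomorphism conditions, transported from classes to representatives, so that the
  arguments below can compute with polynomials only.
\<close>

lemma canonical_properties:
  assumes can: "canonical_E_structure scale T p d \<sigma>"
  shows "Vector_Spaces.linear scale scale (\<sigma> (residue_class p f))"
    and "\<sigma> (residue_class p f) (T v) = T (\<sigma> (residue_class p f) v)"
    and "\<sigma> (residue_class p (f + g)) v = \<sigma> (residue_class p f) v + \<sigma> (residue_class p g) v"
    and "\<sigma> (residue_class p (f * g)) v = \<sigma> (residue_class p f) (\<sigma> (residue_class p g) v)"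
    and "\<sigma> (residue_class p [:c:]) v = scale c v"
    and "\<sigma> (residue_class p 0) v = 0"
proof -
  have inC: "residue_class p f \<in> carrier (ext_ring p)" for f by (simp add: carrier_ext_ring)
  have inv: "T_invariant_E_structure scale T p \<sigma>"
    using can by (simp add: canonical_E_structure_def)
  have hom: "\<sigma> \<in> ring_hom (ext_ring p) (operator_ring scale)"
    and sc: "\<And>c e. e \<in> carrier (ext_ring p) \<Longrightarrow>
        \<sigma> (residue_class p [:c:] \<otimes>\<^bsub>ext_ring p\<^esub> e) = (\<lambda>v. scale c (\<sigma> e v))"
    and cent: "\<And>f. \<sigma> (residue_class p f) \<in> op_centralizer scale T"
    using inv inC by (auto simp: T_invariant_E_structure_def E_structure_def)
  show "Vector_Spaces.linear scale scale (\<sigma> (residue_class p f))"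
    using cent[of f] by (simp add: op_centralizer_def operator_ring_def)
  show "\<sigma> (residue_class p f) (T v) = T (\<sigma> (residue_class p f) v)"
    using cent[of f] by (auto simp: op_centralizer_def o_def dest: fun_cong)
  show add: "\<sigma> (residue_class p (f + g)) v = \<sigma> (residue_class p f) v + \<sigma> (residue_class p g) v"
    for f g
    using ring_hom_add[OF hom inC[of f] inC[of g]] by (simp add: add_ext_ring operator_ring_def)
  show "\<sigma> (residue_class p (f * g)) v = \<sigma> (residue_class p f) (\<sigma> (residue_class p g) v)"
    using ring_hom_mult[OF hom inC[of f] inC[of g]] by (simp add: mult_ext_ring operator_ring_def)
  show "\<sigma> (residue_class p [:c:]) v = scale c v"
    using sc[OF inC[of 1], of c] ring_hom_one[OF hom]
    by (simp add: mult_ext_ring one_ext_ring operator_ring_def)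
  show "\<sigma> (residue_class p 0) v = 0" using add[of 0 0] by simp
qed

text \<open>
  The value at \<open>v\<close> of the class of \<open>x\<close> alone determines the values at \<open>v\<close> of all classes: operators in
  the structure commute with \<open>T\<close>, so each further application of the class of \<open>x\<close> multiplies the
  polynomial in front of \<open>v\<close> by \<open>g\<close>.
\<close>

lemma canonical_local_action:
  assumes can: "canonical_E_structure scale T p d \<sigma>"
    and g: "\<sigma> (residue_class p [:0, 1:]) v = ev g v"
  shows "\<sigma> (residue_class p f) v = ev (pcompose f g) v"
proof (induction f)
  case 0
  show ?case using canonical_properties(6)[OF can] by simp
next
  case (pCons a f)
  let ?S = "\<sigma> (residue_class p [:0, 1:])"
  note S = canonical_properties[OF can]
  have "pCons a f = [:a:] + [:0, 1:] * f" by simp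
  then have "\<sigma> (residue_class p (pCons a f)) v = scale a v + ?S (\<sigma> (residue_class p f) v)"
    by (simp only: S)
  also have "?S (\<sigma> (residue_class p f) v) = ev (pcompose f g) (?S v)"
    unfolding pCons.IH by (rule ev_commute_operator[OF S(1,2)])
  also have "\<dots> = ev (g * pcompose f g) v" by (simp add: g ev_mult mult.commute[of g])
  finally show ?case by (simp add: pcompose_pCons ev_add T_simps)
qed

text \<open>
  Each clause of canonicity contributes one fact: invariance of the cyclic subspace of \<open>v\<close> gives \<open>g\<close>,
  the condition on the top quotient that \<open>v\<close> meets gives the congruence \<open>g \<equiv> x\<close> modulo \<open>p\<close>, and the
  vanishing of the class of \<open>p\<close> makes \<open>g\<close> a root.
\<close>

lemma canonical_local_root:
  assumes can: "canonical_E_structure scale T p d \<sigma>" and p: "irreducible p"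
    and ord: "k < d" "ev (p ^ k) v \<noteq> 0" "ev (p ^ Suc k) v = 0"
  obtains g where "\<sigma> (residue_class p [:0, 1:]) v = ev g v"
    "p dvd g - [:0, 1:]" "p ^ Suc k dvd pcompose p g"
proof -
  let ?S = "\<sigma> (residue_class p [:0, 1:])" and ?U = "ker_filtration scale T p k"
  have "E_subspace scale p \<sigma> (range (\<lambda>f. ev f v))"
    using can cyclic_invariant_subspace by (simp add: canonical_E_structure_def)
  moreover have "v \<in> range (\<lambda>f. ev f v)" by (rule range_eqI[of _ _ 1]) simp
  ultimately have "?S v \<in> range (\<lambda>f. ev f v)"
    unfolding E_subspace_def carrier_ext_ring by blast
  then obtain g where g: "?S v = ev g v" by auto
  have "p dvd g - [:0, 1:]"
  proof -
    define C where "C = vcoset ?U v"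
    have vC: "v \<in> C" unfolding C_def vcoset_def
      by (rule image_eqI[of _ _ 0]) (simp_all add: ker_filtration_0)
    have "Suc k \<in> {1..d}" using ord(1) by simp
    moreover have "C \<in> vquotient (ker_filtration scale T p (Suc k)) (ker_filtration scale T p (Suc k - 1))"
      using ord(3) unfolding vquotient_def C_def diff_Suc_1 by (blast intro: ker_filtration_iff[THEN iffD2])
    ultimately have eq: "induced_op ?U ?S C = induced_op ?U (ev [:0, 1:]) C"
      using can unfolding canonical_E_structure_def by (metis diff_Suc_1)
    have "?S v \<in> vcoset ?U (?S v)" unfolding vcoset_def
      by (rule image_eqI[of _ _ 0]) (simp_all add: ker_filtration_0)
    then have "?S v \<in> induced_op ?U ?S C" unfolding induced_op_def using vC by blast
    then obtain u u' where u: "u \<in> ?U" "u' \<in> ?U" "?S v = ev [:0, 1:] (v + u) + u'"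
      unfolding eq by (auto simp: induced_op_def C_def vcoset_def)
    have "ev (g - [:0, 1:]) v = ev [:0, 1:] u + u'"
      using u(3) unfolding g ev_diff by (simp only: ev_linear_simps) (simp add: algebra_simps)
    also have "\<dots> \<in> ?U" using u by (intro ker_filtration_add ker_filtration_ev)
    finally have "ev (p ^ k * (g - [:0, 1:])) v = 0" by (simp only: ker_filtration_iff ev_mult)
    then have "p ^ Suc k dvd p ^ k * (g - [:0, 1:])"
      by (rule annihilator_power_dvd[OF p ord(2,3)])
    then have "p ^ k * p dvd p ^ k * (g - [:0, 1:])" by (simp add: mult.commute)
    then show ?thesis using p by auto
  qed
  moreover have "p ^ Suc k dvd pcompose p g"
  proof (rule annihilator_power_dvd[OF p ord(2,3)])
    have "residue_class p p = residue_class p 0" 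
      by (auto simp: residue_class_eq dest: dvd_add[OF _ dvd_refl])
    then show "ev (pcompose p g) v = 0"
      using canonical_local_action[OF can g, of p] canonical_properties(6)[OF can, of v] by simp
  qed
  ultimately show ?thesis using that g by blast
qed

text \<open>
  Two structures yield two lifts of the root \<open>x\<close>, which Hensel's lemma identifies modulo the annihilator
  of \<open>v\<close>. Working with each \<open>v\<close> separately avoids one polynomial \<open>g\<close> that serves all vectors.
\<close>

lemma canonical_unique:
  assumes can: "canonical_E_structure scale T p d \<sigma>" "canonical_E_structure scale T p d \<tau>"
    and p: "irreducible p" and sep: "d = 1 \<or> pderiv p \<noteq> 0" and T0: "\<And>v. ev (p ^ d) v = 0"
  shows "\<sigma> (residue_class p f) = \<tau> (residue_class p f)"
proof
  fix v
  show "\<sigma> (residue_class p f) v = \<tau> (residue_class p f) v"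
  proof (cases "v = 0")
    case True
    then show ?thesis
      using linear_selfD(4)[OF canonical_properties(1)] can by metis
  next
    case False
    then obtain k where k: "k < d" "ev (p ^ k) v \<noteq> 0" "ev (p ^ Suc k) v = 0"
      using order_exists[OF T0] by blast
    obtain g where g: "\<sigma> (residue_class p [:0, 1:]) v = ev g v"
      "p dvd g - [:0, 1:]" "p ^ Suc k dvd pcompose p g"
      using canonical_local_root[OF can(1) p k] .
    obtain h where h: "\<tau> (residue_class p [:0, 1:]) v = ev h v"
      "p dvd h - [:0, 1:]" "p ^ Suc k dvd pcompose p h"
      using canonical_local_root[OF can(2) p k] .
    have "p ^ Suc k dvd g - h"
      using hensel_root_unique[OF p _ g(2,3) h(2,3)] sep k(1) by fastforce
    then have "ev (g - h) v = 0" using ev_dvd k(3) by blast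
    then have "\<tau> (residue_class p [:0, 1:]) v = ev g v" by (simp add: h(1) ev_diff)
    then show ?thesis
      using canonical_local_action[OF can(1) g(1)] canonical_local_action[OF can(2)] by metis
  qed
qed

lemma canonical_imp_separable:
  assumes can: "canonical_E_structure scale T p d \<sigma>" and p: "irreducible p" and d: "d \<ge> 1"
    and min: "is_minimal_polynomial scale T (p ^ d)"
  shows "d = 1 \<or> pderiv p \<noteq> 0"
proof (rule ccontr)
  assume "\<not> ?thesis"
  then have d2: "d \<ge> 2" and p': "pderiv p = 0" using d by auto
  then obtain k where k: "d = Suc k" by (cases d) auto
  have p0: "p \<noteq> 0" using p by auto
  have "degree p \<noteq> 0" using p p0 by (metis irreducible_not_unit is_unit_iff_degree)
  then have "degree (p ^ k) < degree (p ^ d)" using p0 by (simp add: k degree_mult_eq)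
  then have "ev (p ^ k) \<noteq> (\<lambda>v. 0)"
    using min p0 unfolding is_minimal_polynomial_def by (metis not_le power_not_zero)
  then obtain w where w: "ev (p ^ k) w \<noteq> 0" by auto
  have "ev (p ^ Suc k) w = 0" using min by (simp add: is_minimal_polynomial_def k)
  then obtain g where g: "p dvd g - [:0, 1:]" "p ^ Suc k dvd pcompose p g"
    using canonical_local_root[OF can p _ w] k by blast
  have "p\<^sup>2 dvd p ^ Suc k" using d2 k by (intro le_imp_power_dvd) simp
  then show False using hensel_root_obstruction[OF p p' g(1)] g(2) dvd_trans by blast
qed

section \<open>The structure defined by an approximate root\<close>

lemma induced_op_cong:
  assumes "\<And>c. c \<in> C \<Longrightarrow> \<exists>u\<in>U. S c = R c + u"
    and U: "\<And>u v. u \<in> U \<Longrightarrow> v \<in> U \<Longrightarrow> u + v \<in> U" "\<And>u v. u \<in> U \<Longrightarrow> v \<in> U \<Longrightarrow> u - v \<in> U"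
  shows "induced_op U S C = induced_op U R C"
proof -
  have "vcoset U (S c) = vcoset U (R c)" if "c \<in> C" for c
  proof -
    obtain u where u: "u \<in> U" "S c = R c + u" using assms(1)[OF \<open>c \<in> C\<close>] by blast
    have "S c + w = R c + (u + w)" "R c + w = S c + (w - u)" for w
      by (simp_all add: u(2) algebra_simps)
    then show ?thesis unfolding vcoset_def using U u(1) by blast
  qed
  then show ?thesis unfolding induced_op_def by simp
qed

text \<open>
  A class acts through an arbitrary representative; the choice is harmless exactly when \<open>p(g)(T) = 0\<close>.
\<close>

definition root_structure :: "'f poly \<Rightarrow> 'f poly set \<Rightarrow> 'v \<Rightarrow> 'v" where
  "root_structure g e = ev (pcompose (SOME f. f \<in> e) g)"

lemma root_structure_residue_class:
  assumes "\<And>v. ev (pcompose p g) v = 0"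
  shows "root_structure g (residue_class p f) = ev (pcompose f g)"
proof
  fix v
  define h where "h = (SOME h. h \<in> residue_class p f)"
  have "h \<in> residue_class p f" unfolding h_def by (rule someI[of _ f]) (simp add: residue_class_eq)
  then obtain q where "h = f + p * q" by (auto simp: residue_class_eq dvd_def algebra_simps)
  then have "ev (pcompose h g) v = ev (pcompose f g) v + ev (pcompose q g) (ev (pcompose p g) v)"
    by (simp add: pcompose_add pcompose_mult ev_add ev_mult mult.commute[of "pcompose p g"])
  then show "root_structure g (residue_class p f) v = ev (pcompose f g) v"
    by (simp add: root_structure_def assms ev_linear_simps flip: h_def)
qed

text \<open>
  All operators of the structure are polynomials in \<open>T\<close>, so they commute with \<open>T\<close> and preserve its
  invariant subspaces. On the quotients, \<open>f(g) - f\<close> is divisible by \<open>g - x\<close>, hence by \<open>p\<close>, and \<open>p(T)\<close>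
  lowers the filtration by one step.
\<close>

lemma root_structure_canonical:
  assumes g: "p dvd g - [:0, 1:]" and pg: "\<And>v. ev (pcompose p g) v = 0"
  shows "canonical_E_structure scale T p d (root_structure g)"
proof -
  note [simp] = root_structure_residue_class[OF pg]
  have "root_structure g \<in> ring_hom (ext_ring p) (operator_ring scale)"
    by (rule ring_hom_memI)
      (auto simp: carrier_ext_ring mult_ext_ring add_ext_ring one_ext_ring operator_ring_def
        ev_linear pcompose_mult pcompose_add pcompose_1 ev_mult ev_add)
  then have E: "E_structure scale p (root_structure g)"
    by (auto simp: E_structure_def carrier_ext_ring mult_ext_ring pcompose_smult ev_smult)
  have "ev f (T v) = T (ev f v)" for f v
    by (rule ev_commute_operator[OF T_linear, symmetric]) simp
  then have inv: "T_invariant_E_structure scale T p (root_structure g)"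
    using E by (auto simp: T_invariant_E_structure_def carrier_ext_ring op_centralizer_def
        operator_ring_def ev_linear)
  have sub: "E_subspace scale p (root_structure g) W" if "T_invariant_subspace scale T W" for W
    using that ev_invariant_subspace[OF that]
    by (auto simp: E_subspace_def carrier_ext_ring T_invariant_subspace_def)
  have quot: "induced_op (ker_filtration scale T p (i - 1)) (root_structure g (residue_class p f)) C =
      induced_op (ker_filtration scale T p (i - 1)) (ev f) C"
    if i: "i \<in> {1..d}"
      and C: "C \<in> vquotient (ker_filtration scale T p i) (ker_filtration scale T p (i - 1))"
    for i f C
  proof (rule induced_op_cong)
    fix c assume "c \<in> C"
    obtain j where j: "i = Suc j" using i by (cases i) auto
    obtain v u where v: "ev (p ^ Suc j) v = 0" "ev (p ^ j) u = 0" "c = v + u"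
      using C \<open>c \<in> C\<close> by (auto simp: vquotient_def vcoset_def ker_filtration_iff j)
    have "ev (p ^ Suc j) u = 0" using v(2) by (simp add: ev_mult ev_linear_simps)
    then have c: "ev (p ^ Suc j) c = 0" by (simp only: v ev_linear_simps add_0)
    have "p dvd pcompose f g - f"
      using dvd_trans[OF g pcompose_diff_dvd[of g "[:0, 1:]" f]] by simp
    then have "p ^ Suc j dvd p ^ j * (pcompose f g - f)" by (simp add: mult.commute)
    then have "ev (p ^ j * (pcompose f g - f)) c = 0" using c by (rule ev_dvd)
    then have "ev (pcompose f g - f) c \<in> ker_filtration scale T p (i - 1)"
      by (simp add: ker_filtration_iff j ev_mult)
    moreover have "root_structure g (residue_class p f) c = ev f c + ev (pcompose f g - f) c"
      by (simp add: ev_diff)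
    ultimately show "\<exists>u\<in>ker_filtration scale T p (i - 1).
        root_structure g (residue_class p f) c = ev f c + u" by blast
  qed (auto intro: ker_filtration_add ker_filtration_diff)
  show ?thesis unfolding canonical_E_structure_def using inv sub quot by blast
qed

end

theorem theorem5p1:
  fixes scale :: "'f::field \<Rightarrow> 'v::ab_group_add \<Rightarrow> 'v"
    and Basis :: "'v set"
    and T :: "'v \<Rightarrow> 'v"
    and p :: "'f poly"
    and d :: nat
  assumes "finite_dimensional_vector_space scale Basis"
    and "Vector_Spaces.linear scale scale T"
    and "lead_coeff p = 1"
    and "irreducible p"
    and "d \<ge> 1"
    and "is_minimal_polynomial scale T (p ^ d)"
  shows "((\<exists>\<sigma>. canonical_E_structure scale T p d \<sigma>) \<longleftrightarrow> d = 1 \<or> pderiv p \<noteq> 0) \<and>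
         (\<forall>\<sigma> \<tau>. canonical_E_structure scale T p d \<sigma> \<and> canonical_E_structure scale T p d \<tau> \<longrightarrow>
            (\<forall>e \<in> carrier (ext_ring p). \<sigma> e = \<tau> e))"
proof -
  interpret linear_operator scale T
    by (intro linear_operator.intro linear_operator_axioms.intro assms(2)
        finite_dimensional_vector_space.axioms(1)[OF assms(1)])
  have T0: "ev (p ^ d) v = 0" for v using assms(6) by (simp add: is_minimal_polynomial_def)
  have nec: "d = 1 \<or> pderiv p \<noteq> 0" if "canonical_E_structure scale T p d \<sigma>" for \<sigma>
    using canonical_imp_separable[OF that assms(4,5,6)] .
  have "\<exists>\<sigma>. canonical_E_structure scale T p d \<sigma>" if sep: "d = 1 \<or> pderiv p \<noteq> 0"
  proof -
    obtain g where g: "p dvd g - [:0, 1:]" "p ^ Suc (d - 1) dvd pcompose p g"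
      using hensel_root_exists[OF assms(4), of "d - 1"] sep by auto
    have "ev (pcompose p g) v = 0" for v
      using ev_dvd[OF g(2)] T0 assms(5) by simp
    then show ?thesis using root_structure_canonical[OF g(1)] by blast
  qed
  then show ?thesis
    using nec canonical_unique[OF _ _ assms(4) _ T0] by (auto simp: carrier_ext_ring)
qed

end
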